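(* Every nice bipartite graph $G$ with minimum degree $\delta(G)\ge 6$ admits an adjacent vertex-distinguishing $2$-edge-weighting.
   Context: All graphs are finite, undirected and simple. A graph is nice if no connected component of it is a single edge ($K_2$). A $k$-edge-weighting of $G$ is a map $w:E(G)\to\{1,\dots,k\}$. For a vertex $v$, let $X_v$ be the multiset of weights of the edges incident with $v$. The edge-weighting is adjacent vertex-distinguishing if $X_u\ne X_v$ for every edge $uv\in E(G)$ (incident edges are allowed to have the same weight). *)

theory Defs
  imports "HOL-Library.Multiset" "HOL-Library.FuncSet"
begin

text \<open>A graph is a vertex set \<open>V\<close> with an edge set \<open>E\<close> of two-element subsets of \<open>V\<close>.\<close>

definition simple_graph :: "'a set \<Rightarrow> 'a set set \<Rightarrow> bool" where
  "simple_graph V E \<longleftrightarrow> finite V \<and> (\<forall>e\<in>E. e \<subseteq> V \<and> card e = 2)"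

definition bipartite :: "'a set \<Rightarrow> 'a set set \<Rightarrow> bool" where
  "bipartite V E \<longleftrightarrow>
     (\<exists>A B. A \<inter> B = {} \<and> A \<union> B = V \<and> (\<forall>e\<in>E. \<exists>a\<in>A. \<exists>b\<in>B. e = {a, b}))"

definition incident_edges :: "'a set set \<Rightarrow> 'a \<Rightarrow> 'a set set" where
  "incident_edges E v = {e \<in> E. v \<in> e}"

definition degree :: "'a set set \<Rightarrow> 'a \<Rightarrow> nat" where
  "degree E v = card (incident_edges E v)"

text \<open>Unspecified (\<^term>\<open>Min {}\<close>) for the graph without vertices.\<close>

definition min_degree :: "'a set \<Rightarrow> 'a set set \<Rightarrow> nat" where
  "min_degree V E = Min (degree E ` V)"

definition connected_rel :: "'a set \<Rightarrow> 'a set set \<Rightarrow> ('a \<times> 'a) set" where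
  "connected_rel V E = {(u, v). u \<in> V \<and> v \<in> V \<and> (u, v) \<in> {(x, y). {x, y} \<in> E}\<^sup>*}"

text \<open>Each connected component is given with its own vertex set and edge set.\<close>

definition components :: "'a set \<Rightarrow> 'a set set \<Rightarrow> ('a set \<times> 'a set set) set" where
  "components V E = (\<lambda>C. (C, {e \<in> E. e \<subseteq> C})) ` (V // connected_rel V E)"

definition is_K2 :: "'a set \<Rightarrow> 'a set set \<Rightarrow> bool" where
  "is_K2 V E \<longleftrightarrow> (\<exists>u v. u \<noteq> v \<and> V = {u, v} \<and> E = {{u, v}})"

definition nice :: "'a set \<Rightarrow> 'a set set \<Rightarrow> bool" where
  "nice V E \<longleftrightarrow> (\<forall>(C, F) \<in> components V E. \<not> is_K2 C F)"

definition edge_weighting :: "nat \<Rightarrow> 'a set set \<Rightarrow> ('a set \<Rightarrow> nat) \<Rightarrow> bool" where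
  "edge_weighting k E w \<longleftrightarrow> w \<in> E \<rightarrow> {1..k}"

text \<open>The multiset $X_v$; meaningful when \<open>E\<close> is finite, as \<^term>\<open>mset_set\<close> of an infinite
  set is empty.\<close>

definition incident_weights :: "'a set set \<Rightarrow> ('a set \<Rightarrow> nat) \<Rightarrow> 'a \<Rightarrow> nat multiset" where
  "incident_weights E w v = image_mset w (mset_set (incident_edges E v))"

definition adjacent_vertex_distinguishing :: "'a set set \<Rightarrow> ('a set \<Rightarrow> nat) \<Rightarrow> bool" where
  "adjacent_vertex_distinguishing E w \<longleftrightarrow>
     (\<forall>u v. {u, v} \<in> E \<longrightarrow> incident_weights E w u \<noteq> incident_weights E w v)"

end

theory Submission
  imports Defs "HOL-Library.Transitive_Closure_Table"
begin

text \<open>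
  With only the weights 1 and 2, two adjacent vertices have equal multisets iff their degrees agree
  and equally many edges of weight 1 meet them. Let \<open>half v\<close> be half the degree of \<open>v\<close>, rounded
  down. It suffices to choose the edges of weight 1 such that every vertex of one side \<open>X\<close> meets
  \<open>half x\<close> or \<open>half x + 1\<close> of them and every vertex of the other side \<open>Y\<close> meets \<open>half y - 1\<close> or
  \<open>half y + 2\<close> of them: for vertices of equal degree these two pairs of values are disjoint.

  An edge set is encoded as an orientation, the edges of weight 1 being those directed from \<open>X\<close> to
  \<open>Y\<close>. The number of weight-1 edges at a vertex is then an out-degree on \<open>X\<close> and an in-degree on
  \<open>Y\<close>, and an alternating path becomes a directed path: reversing one changes degrees only at its
  two ends.

  Among the orientations that exceed none of the upper values, take one that minimises the total
  amount missing: a vertex of \<open>X\<close> lacks what separates its out-degree from \<open>half x\<close>, a vertex of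
  \<open>Y\<close> what separates its in-degree from the smaller of its two values not below it. Nothing is missing in
  such an optimal orientation. Otherwise look at the set \<open>R\<close> of vertices joined by directed paths to
  a defective vertex, towards it if it lies in \<open>X\<close> and away from it if it lies in \<open>Y\<close>. Optimality
  forbids every local improvement, and this determines the degrees in \<open>R\<close> so well that arcs inside
  \<open>R\<close>, counted by their tails and by their heads, give different numbers.

  The improvements combine the reversal of a path (\<open>optimal_no_transfer\<close>) with a jump of a vertex
  of \<open>Y\<close> from one of its two values to the other: up by three in \<open>optimal_no_large_fan\<close>, down by
  three in \<open>optimal_no_two_saturated\<close>. The last of these may create a new defect in \<open>X\<close> in exchange
  for one in \<open>Y\<close>; this is still contradictory because defects in \<open>X\<close> are excluded first
  (\<open>optimal_X_no_defect\<close>). A minimum degree of 6, that is \<open>half v \<ge> 3\<close>, makes the final counts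
  work.
\<close>

section \<open>Orientations and reversal of arcs\<close>

text \<open>Edges of the underlying graph are given as a symmetric relation \<open>U\<close>.\<close>

definition orientation :: "('a \<times> 'a) set \<Rightarrow> ('a \<times> 'a) set \<Rightarrow> bool" where
  "orientation U D \<longleftrightarrow> D \<union> D\<inverse> = U \<and> D \<inter> D\<inverse> = {}"

definition reverse_arcs :: "('a \<times> 'a) set \<Rightarrow> ('a \<times> 'a) set \<Rightarrow> ('a \<times> 'a) set" where
  "reverse_arcs D A = (D - A) \<union> A\<inverse>"

abbreviation outdeg :: "('a \<times> 'a) set \<Rightarrow> 'a \<Rightarrow> nat" where
  "outdeg D v \<equiv> card (D `` {v})"

abbreviation indeg :: "('a \<times> 'a) set \<Rightarrow> 'a \<Rightarrow> nat" where
  "indeg D v \<equiv> card (D\<inverse> `` {v})"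

lemma orientation_reverse_arcs:
  assumes "orientation U D" "A \<subseteq> D"
  shows "orientation U (reverse_arcs D A)"
proof -
  have "U = D \<union> D\<inverse>" "D \<inter> D\<inverse> = {}"
    using assms(1) by (simp_all add: orientation_def)
  moreover have "reverse_arcs D A \<union> (reverse_arcs D A)\<inverse> = D \<union> D\<inverse>"
    using assms(2) by (auto simp: reverse_arcs_def)
  moreover have "reverse_arcs D A \<inter> (reverse_arcs D A)\<inverse> = {}" if "D \<inter> D\<inverse> = {}"
    using assms(2) that by (auto simp: reverse_arcs_def)
  ultimately show ?thesis by (simp add: orientation_def)
qed

text \<open>Stated as an identity of sums to avoid truncated subtraction.\<close>

lemma outdeg_reverse_arcs:
  assumes "finite D" "D \<inter> D\<inverse> = {}" "A \<subseteq> D"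
  shows "outdeg (reverse_arcs D A) w + outdeg A w = outdeg D w + indeg A w"
proof -
  have eq: "reverse_arcs D A `` {w} = (D `` {w} - A `` {w}) \<union> A\<inverse> `` {w}"
    unfolding reverse_arcs_def by blast
  have fin: "finite (D `` {w})" "finite (A `` {w})" "finite (A\<inverse> `` {w})"
    using assms finite_subset[OF assms(3,1)] by auto
  have "(D `` {w} - A `` {w}) \<inter> A\<inverse> `` {w} = {}"
    using assms by blast
  then have "outdeg (reverse_arcs D A) w = card (D `` {w} - A `` {w}) + indeg A w"
    unfolding eq using fin by (intro card_Un_disjoint) auto
  moreover have "A `` {w} \<subseteq> D `` {w}" using assms by blast
  ultimately show ?thesis
    using fin card_mono[OF fin(1), of "A `` {w}"] by (simp add: card_Diff_subset)
qed

lemma indeg_reverse_arcs: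
  assumes "finite D" "D \<inter> D\<inverse> = {}" "A \<subseteq> D"
  shows "indeg (reverse_arcs D A) w + indeg A w = indeg D w + outdeg A w"
proof -
  have "(reverse_arcs D A)\<inverse> = reverse_arcs (D\<inverse>) (A\<inverse>)"
    unfolding reverse_arcs_def by blast
  moreover have "outdeg (reverse_arcs (D\<inverse>) (A\<inverse>)) w + outdeg (A\<inverse>) w
      = outdeg (D\<inverse>) w + indeg (A\<inverse>) w"
    using assms by (intro outdeg_reverse_arcs) auto
  ultimately show ?thesis by simp
qed

lemma orientation_degrees:
  assumes "finite U" "orientation U D"
  shows "outdeg D v + indeg D v = card (U `` {v})"
proof -
  have "U `` {v} = D `` {v} \<union> D\<inverse> `` {v}" "D `` {v} \<inter> D\<inverse> `` {v} = {}"
    using assms(2) unfolding orientation_def by blast+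
  moreover have "finite (U `` {v})" using assms(1) by simp
  ultimately show ?thesis by (simp add: card_Un_disjoint)
qed

section \<open>Directed paths and fans\<close>

text \<open>Only the degrees of the arc set of a simple path from \<open>u\<close> to \<open>v\<close> matter, so they serve as its
  description; disjoint directed cycles may be present.\<close>

definition path_arcs :: "('a \<times> 'a) set \<Rightarrow> 'a \<Rightarrow> 'a \<Rightarrow> bool" where
  "path_arcs P u v \<longleftrightarrow> outdeg P u = 1 \<and> indeg P u = 0 \<and> outdeg P v = 0 \<and> indeg P v = 1 \<and>
     (\<forall>w. w \<noteq> u \<longrightarrow> w \<noteq> v \<longrightarrow> outdeg P w = indeg P w)"

lemma path_arcs_degrees:
  assumes "path_arcs P u v"
  shows "outdeg P u = 1" "indeg P u = 0" "outdeg P v = 0" "indeg P v = 1"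
    "w \<noteq> u \<Longrightarrow> w \<noteq> v \<Longrightarrow> outdeg P w = indeg P w"
  using assms by (simp_all add: path_arcs_def)

text \<open>Simplicity of the path is essential: it keeps the in- and out-degree at each end at most 1. An
  arbitrary walk is shortened to one without repeated vertices, along which the induction keeps
  \<open>Field P\<close> inside the vertices visited, so that a newly added first vertex is untouched by \<open>P\<close>.\<close>

lemma path_arcs_exist:
  assumes "(u, v) \<in> D\<^sup>*" "u \<noteq> v"
  shows "\<exists>P\<subseteq>D. path_arcs P u v"
proof -
  let ?good = "\<lambda>u v P. P \<subseteq> D \<and> (\<exists>a. P `` {u} = {a}) \<and> P\<inverse> `` {u} = {} \<and>
    P `` {v} = {} \<and> (\<exists>b. P\<inverse> `` {v} = {b}) \<and>
    (\<forall>w. w \<noteq> u \<longrightarrow> w \<noteq> v \<longrightarrow> outdeg P w = indeg P w)"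
  have main: "\<exists>P. Field P \<subseteq> set (u # xs) \<and> ?good u v P"
    if "rtrancl_path (\<lambda>a b. (a, b) \<in> D) u xs v" "distinct (u # xs)" "xs \<noteq> []" for u v xs
    using that
  proof (induction rule: rtrancl_path.induct)
    case (base x)
    then show ?case by simp
  next
    case (step x y ys z)
    show ?case
    proof (cases "ys = []")
      case True
      then have "z = y" using step.hyps(2) by (auto elim: rtrancl_path.cases)
      then have "?good x z {(x, y)}" using step.hyps step.prems
        by (auto simp: Image_def)
      then show ?thesis using True \<open>z = y\<close> by (intro exI[of _ "{(x, y)}"]) auto
    next
      case False
      then obtain P where P: "Field P \<subseteq> set (y # ys)" "?good y z P"
        using step by auto
      have zin: "z \<in> set ys"
        using step.hyps(2) False by (metis last_in_set rtrancl_path_last)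
      let ?P = "insert (x, y) P"
      have x: "x \<notin> Field P" "x \<noteq> y" "x \<noteq> z" "y \<noteq> z"
        using P(1) step.prems zin by auto
      have out: "?P `` {w} = (if w = x then {y} else P `` {w})" for w
        using x by (auto simp: Field_def)
      have inn: "?P\<inverse> `` {w} = (if w = x then {} else if w = y then {x} else P\<inverse> `` {w})" for w
        using x P(2) by (auto simp: Field_def)
      have "?good x z ?P"
        unfolding out inn using P(2) step.hyps x by (auto 0 3)
      moreover have "Field ?P \<subseteq> set (x # y # ys)" using P(1) by auto
      ultimately have "Field ?P \<subseteq> set (x # y # ys) \<and> ?good x z ?P" by (rule conjI[rotated])
      then show ?thesis by (rule exI[where x = ?P])
    qed
  qed
  have "rtranclp (\<lambda>a b. (a, b) \<in> D) u v"
    using assms(1) by (simp add: rtranclp_rtrancl_eq)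
  then obtain xs where "rtrancl_path (\<lambda>a b. (a, b) \<in> D) u xs v"
    unfolding rtranclp_eq_rtrancl_path by blast
  then obtain ys where ys: "rtrancl_path (\<lambda>a b. (a, b) \<in> D) u ys v" "distinct (u # ys)"
    by (rule rtrancl_path_distinct)
  moreover have "ys \<noteq> []" using ys(1) assms(2) by (auto elim: rtrancl_path.cases)
  ultimately obtain P where "?good u v P" using main[of u ys v] by blast
  then show ?thesis unfolding path_arcs_def by (intro exI[of _ P]) auto
qed

text \<open>A fan of arcs with common tail \<open>y\<close>, added to a path, lets \<open>y\<close> change its degree by more than
  one; applied to converse relations it describes a fan with common head.\<close>

lemma degrees_add_fan:
  assumes "finite P" "finite S" "P `` {y} \<inter> S = {}"
  shows "outdeg (P \<union> {y} \<times> S) w = outdeg P w + (if w = y then card S else 0)"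
    and "indeg (P \<union> {y} \<times> S) w = indeg P w + (if w \<in> S then 1 else 0)"
proof -
  have "(P \<union> {y} \<times> S) `` {w} = P `` {w} \<union> (if w = y then S else {})" by auto
  then show "outdeg (P \<union> {y} \<times> S) w = outdeg P w + (if w = y then card S else 0)"
    using assms by (simp add: card_Un_disjoint)
  have "y \<notin> P\<inverse> `` {w}" if "w \<in> S" using assms(3) that by blast
  moreover have "(P \<union> {y} \<times> S)\<inverse> `` {w} = P\<inverse> `` {w} \<union> (if w \<in> S then {y} else {})" by auto
  ultimately show "indeg (P \<union> {y} \<times> S) w = indeg P w + (if w \<in> S then 1 else 0)"
    using assms by (auto simp: card_insert_if)
qed

section \<open>Counting arcs in a closed set\<close>

text \<open>If no arc leaves \<open>R\<close>, both sides count the arcs inside \<open>R\<close>, by tails and by heads.\<close>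

lemma degree_sums_on_closed_set:
  assumes "finite D" "finite R" "D `` R \<subseteq> R"
  shows "(\<Sum>v\<in>R. outdeg D v) = (\<Sum>v\<in>R. card (D\<inverse> `` {v} \<inter> R))"
proof -
  have "(\<Sum>v\<in>R. outdeg D v) = card (SIGMA v:R. D `` {v})"
    using assms by (subst card_SigmaI) auto
  also have "\<dots> = card (SIGMA v:R. D\<inverse> `` {v} \<inter> R)"
  proof (rule bij_betw_same_card)
    show "bij_betw prod.swap (SIGMA v:R. D `` {v}) (SIGMA v:R. D\<inverse> `` {v} \<inter> R)"
      by (rule bij_betwI[where g = prod.swap]) (use assms(3) in auto)
  qed
  also have "\<dots> = (\<Sum>v\<in>R. card (D\<inverse> `` {v} \<inter> R))"
    using assms by (subst card_SigmaI) auto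
  finally show ?thesis .
qed

lemma no_strict_surplus_on_closed_set:
  assumes "finite D" "finite R" "D `` R \<subseteq> R"
    and "\<And>v. v \<in> R \<Longrightarrow> card (D\<inverse> `` {v} \<inter> R) \<le> outdeg D v"
    and "v0 \<in> R" "card (D\<inverse> `` {v0} \<inter> R) < outdeg D v0"
  shows False
proof -
  have "(\<Sum>v\<in>R. card (D\<inverse> `` {v} \<inter> R)) < (\<Sum>v\<in>R. outdeg D v)"
    using assms by (intro sum_strict_mono_ex1) auto
  then show False using degree_sums_on_closed_set[OF assms(1-3)] by simp
qed

section \<open>Optimal orientations of a bipartite graph\<close>

locale bipartite_relation =
  fixes X Y :: "'a set" and U :: "('a \<times> 'a) set"
  assumes finX: "finite X" and finY: "finite Y" and disj: "X \<inter> Y = {}"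
    and between: "U \<subseteq> X \<times> Y \<union> Y \<times> X" and symU: "sym U"
    and deg6: "v \<in> X \<union> Y \<Longrightarrow> 6 \<le> card (U `` {v})"
begin

definition half :: "'a \<Rightarrow> nat" where
  "half v = card (U `` {v}) div 2"

definition admissible :: "('a \<times> 'a) set \<Rightarrow> bool" where
  "admissible D \<longleftrightarrow> orientation U D \<and> (\<forall>x\<in>X. outdeg D x \<le> half x + 1) \<and>
     (\<forall>y\<in>Y. indeg D y \<le> half y + 2)"

text \<open>The in-degrees aimed at on \<open>Y\<close> are \<open>half v - 1\<close> and \<open>half v + 2\<close>, and the defect is the distance
  up to the nearest of them that is not exceeded. Lowering the in-degree from \<open>half v\<close> to
  \<open>half v - 1\<close> therefore also removes a defect, of size 2.\<close>

definition defect :: "('a \<times> 'a) set \<Rightarrow> 'a \<Rightarrow> nat" where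
  "defect D v = (if v \<in> X then half v - outdeg D v
     else if indeg D v < half v then half v - 1 - indeg D v else half v + 2 - indeg D v)"

definition total_defect :: "('a \<times> 'a) set \<Rightarrow> nat" where
  "total_defect D = (\<Sum>v\<in>X \<union> Y. defect D v)"

definition optimal :: "('a \<times> 'a) set \<Rightarrow> bool" where
  "optimal D \<longleftrightarrow> admissible D \<and> (\<forall>D'. admissible D' \<longrightarrow> total_defect D \<le> total_defect D')"

lemma finU: "finite U"
  by (rule finite_subset[OF between]) (use finX finY in auto)

lemma half_bounds:
  assumes "v \<in> X \<union> Y"
  shows "3 \<le> half v" "2 * half v \<le> card (U `` {v})" "card (U `` {v}) \<le> 2 * half v + 1"
  using deg6[OF assms] unfolding half_def by auto

lemma defectX: "x \<in> X \<Longrightarrow> defect D x = half x - outdeg D x"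
  by (simp add: defect_def)

lemma defectY:
  "y \<in> Y \<Longrightarrow> defect D y =
     (if indeg D y < half y then half y - 1 - indeg D y else half y + 2 - indeg D y)"
  using disj by (auto simp: defect_def)

text \<open>All upper bounds hold when every edge is directed from \<open>Y\<close> to \<open>X\<close>.\<close>

lemma exists_optimal: "\<exists>D. optimal D"
proof -
  let ?D = "U \<inter> (Y \<times> X)"
  have "orientation U ?D"
    unfolding orientation_def using between symU disj by (auto elim: symE)
  moreover have "?D `` {x} = {}" if "x \<in> X" for x using that disj by auto
  moreover have "?D\<inverse> `` {y} = {}" if "y \<in> Y" for y using that disj by auto
  ultimately have "admissible ?D" unfolding admissible_def by simp
  then show ?thesis
    using ex_has_least_nat[of admissible ?D total_defect] unfolding optimal_def by blast
qed

lemma admissible_orientation: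
  assumes "admissible D"
  shows "finite D" "D \<inter> D\<inverse> = {}" "D \<subseteq> X \<times> Y \<union> Y \<times> X"
    "outdeg D v + indeg D v = card (U `` {v})"
proof -
  have o: "orientation U D" using assms by (simp add: admissible_def)
  then show "D \<inter> D\<inverse> = {}" by (simp add: orientation_def)
  have "D \<subseteq> U" using o by (auto simp: orientation_def)
  then show "finite D" "D \<subseteq> X \<times> Y \<union> Y \<times> X"
    using finU between finite_subset by blast+
  show "outdeg D v + indeg D v = card (U `` {v})"
    using orientation_degrees[OF finU o] .
qed

lemma optimal_no_improvement:
  assumes "optimal D" "admissible D'"
    and "\<And>v. v \<in> X \<union> Y \<Longrightarrow> defect D' v \<le> defect D v"
    and "v0 \<in> X \<union> Y" "defect D' v0 < defect D v0"
  shows False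
proof -
  have "total_defect D' < total_defect D"
    unfolding total_defect_def using assms finX finY by (intro sum_strict_mono_ex1) auto
  then show False using assms(1,2) unfolding optimal_def by (meson leD)
qed

lemma admissible_reverse_arcs:
  assumes "admissible D" "A \<subseteq> D"
    and "\<And>x. x \<in> X \<Longrightarrow> outdeg D x + indeg A x \<le> half x + 1 + outdeg A x"
    and "\<And>y. y \<in> Y \<Longrightarrow> indeg D y + outdeg A y \<le> half y + 2 + indeg A y"
  shows "admissible (reverse_arcs D A)"
proof -
  note fin = admissible_orientation(1,2)[OF assms(1)]
  have "orientation U (reverse_arcs D A)"
    using assms(1,2) by (auto simp: admissible_def intro: orientation_reverse_arcs)
  moreover have "outdeg (reverse_arcs D A) x \<le> half x + 1" if "x \<in> X" for x
    using outdeg_reverse_arcs[OF fin assms(2), of x] assms(3)[OF that] by linarith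
  moreover have "indeg (reverse_arcs D A) y \<le> half y + 2" if "y \<in> Y" for y
    using indeg_reverse_arcs[OF fin assms(2), of y] assms(4)[OF that] by linarith
  ultimately show ?thesis unfolding admissible_def by blast
qed

lemma optimal_no_reversal:
  assumes "optimal D" "A \<subseteq> D"
    and X: "\<And>x. x \<in> X \<Longrightarrow> outdeg D x + indeg A x \<le> half x + 1 + outdeg A x"
    and Y: "\<And>y. y \<in> Y \<Longrightarrow> indeg D y + outdeg A y \<le> half y + 2 + indeg A y"
    and mono: "\<And>v. v \<in> X \<union> Y \<Longrightarrow> defect (reverse_arcs D A) v \<le> defect D v"
    and v0: "v0 \<in> X \<union> Y" "defect (reverse_arcs D A) v0 < defect D v0"
  shows False
proof -
  have adm: "admissible D" using assms(1) unfolding optimal_def by (rule conjunct1)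
  have adm': "admissible (reverse_arcs D A)"
    by (rule admissible_reverse_arcs[OF adm assms(2) X Y])
  show False by (rule optimal_no_improvement[OF assms(1) adm' mono v0])
qed

section \<open>Defects in X are impossible\<close>

text \<open>Reversing a path from \<open>u\<close> to \<open>v\<close> takes one out-arc from \<open>u\<close> and gives one to \<open>v\<close>. A vertex of \<open>X\<close>
  with the upper of its two admitted out-degrees can afford this, and a defective vertex of \<open>Y\<close> gains
  from it, as its in-degree grows; \<open>v\<close> has room for the extra arc and gains if it is defective.\<close>

lemma optimal_no_transfer:
  assumes opt: "optimal D" and path: "(u, v) \<in> D\<^sup>*"
    and u: "u \<in> X \<and> outdeg D u = half u + 1 \<or> u \<in> Y \<and> 0 < defect D u"
    and v: "v \<in> X" "outdeg D v \<le> half v"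
    and gain: "0 < defect D u \<or> 0 < defect D v"
  shows False
proof -
  have adm: "admissible D" using opt by (simp add: optimal_def)
  have "u \<noteq> v" using u v disj by auto
  then obtain P where P: "P \<subseteq> D" "path_arcs P u v"
    using path_arcs_exist[OF path] by blast
  note deg = path_arcs_degrees[OF P(2)]
  note D = admissible_orientation[OF adm]
  note out = outdeg_reverse_arcs[OF D(1,2) P(1)]
  note inn = indeg_reverse_arcs[OF D(1,2) P(1)]
  have defu: "defect (reverse_arcs D P) u \<le> defect D u"
    "u \<in> Y \<Longrightarrow> defect (reverse_arcs D P) u < defect D u"
    using u out[of u] inn[of u] deg(1,2) disj by (auto simp: defect_def split: if_splits)
  have defv: "defect (reverse_arcs D P) v \<le> defect D v"
    "0 < defect D v \<Longrightarrow> defect (reverse_arcs D P) v < defect D v"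
    using v out[of v] deg(3,4) by (auto simp: defectX)
  have u': "u \<in> Y" if "0 < defect D u" using u that by (auto simp: defectX)
  obtain v0 where v0: "v0 \<in> {u, v}" "defect (reverse_arcs D P) v0 < defect D v0"
    using gain u' defu defv by blast
  show False
  proof (rule optimal_no_reversal[OF opt P(1) _ _ _ _ v0(2)])
    fix x assume x: "x \<in> X"
    then have le: "outdeg D x \<le> half x + 1" using adm by (simp add: admissible_def)
    show "outdeg D x + indeg P x \<le> half x + 1 + outdeg P x"
      using le v(2) deg(1-4) deg(5)[of x] by (cases "x = u"; cases "x = v") auto
  next
    fix y assume y: "y \<in> Y"
    then have le: "indeg D y \<le> half y + 2" using adm by (simp add: admissible_def)
    have "y \<noteq> v" using y v(1) disj by auto
    moreover have "indeg D y < half y + 2" if "y = u"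
      using u that y disj by (auto simp: defectY split: if_splits)
    ultimately show "indeg D y + outdeg P y \<le> half y + 2 + indeg P y"
      using le deg(1,2) deg(5)[of y] by (cases "y = u") auto
  next
    fix w assume "w \<in> X \<union> Y"
    show "defect (reverse_arcs D P) w \<le> defect D w"
    proof (cases "w = u \<or> w = v")
      case True
      then show ?thesis using defu(1) defv(1) by auto
    next
      case False
      then show ?thesis using deg(5)[of w] out[of w] inn[of w] by (simp add: defect_def)
    qed
  next
    show "v0 \<in> X \<union> Y" using v0(1) u v by auto
  qed
qed

text \<open>Here \<open>y\<close> jumps from in-degree \<open>half y - 1\<close> to \<open>half y + 2\<close>: one of its out-arcs is reversed
  with a path to \<open>x0\<close>, whose defect shrinks, and two more are reversed on their own. Their heads
  have out-degree low enough to receive another out-arc; this includes \<open>x0\<close>, which may be one of the two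
  and then receives two arcs.\<close>

lemma optimal_no_large_fan:
  assumes opt: "optimal D" and x0: "x0 \<in> X" "outdeg D x0 < half x0"
    and y: "y \<in> Y" "indeg D y = half y - 1" "(y, x0) \<in> D\<^sup>*"
    and T: "T \<subseteq> D `` {y}" "3 \<le> card T" "\<And>x. x \<in> T \<Longrightarrow> outdeg D x \<le> half x"
  shows False
proof -
  have adm: "admissible D" using opt by (simp add: optimal_def)
  note D = admissible_orientation[OF adm]
  have "y \<noteq> x0" using y x0 disj by auto
  then obtain P where P: "P \<subseteq> D" "path_arcs P y x0"
    using path_arcs_exist[OF y(3)] by blast
  note deg = path_arcs_degrees[OF P(2)]
  have finP: "finite P" using P(1) D(1) finite_subset by blast
  \<comment> \<open>The path uses one out-arc of \<open>y\<close>, with head \<open>a\<close>, so the other two must avoid \<open>a\<close>.\<close>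
  obtain a where a: "P `` {y} = {a}" using deg(1) card_1_singletonE by metis
  have "2 \<le> card (T - {a})" using T(2) by (cases "a \<in> T") (auto simp: card_Diff_singleton)
  then obtain S where S: "S \<subseteq> T - {a}" "card S = 2" "finite S"
    by (rule obtain_subset_with_card_n)
  have SX: "S \<subseteq> X" using S(1) T(1) D(3) y(1) disj by blast
  define A where "A = P \<union> {y} \<times> S"
  have A: "A \<subseteq> D" using P(1) S(1) T(1) by (auto simp: A_def)
  have "P `` {y} \<inter> S = {}" using S(1) a by auto
  note fan = degrees_add_fan[OF finP S(3) this, folded A_def]
  note out = outdeg_reverse_arcs[OF D(1,2) A, unfolded fan]
  note inn = indeg_reverse_arcs[OF D(1,2) A, unfolded fan]
  have half_y: "3 \<le> half y" using half_bounds(1) y(1) by blast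
  have yS: "y \<notin> S" and x0y: "x0 \<noteq> y" using SX y(1) x0(1) disj by auto
  show False
  proof (rule optimal_no_reversal[OF opt A, where ?v0.0 = x0])
    fix x assume x: "x \<in> X"
    then have le: "outdeg D x \<le> half x + 1" using adm by (simp add: admissible_def)
    have "x \<noteq> y" using x y(1) disj by auto
    moreover have "outdeg D x \<le> half x" if "x \<in> S" using T(3) S(1) that by auto
    ultimately show "outdeg D x + indeg A x \<le> half x + 1 + outdeg A x"
      unfolding fan using le x0(2) deg(3,4) deg(5)[of x] by (cases "x = x0") auto
  next
    fix w assume w: "w \<in> Y"
    then have le: "indeg D w \<le> half w + 2" using adm by (simp add: admissible_def)
    have "w \<noteq> x0" "w \<notin> S" using w x0(1) SX disj by auto
    then show "indeg D w + outdeg A w \<le> half w + 2 + indeg A w"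
      unfolding fan using le y(2) half_y S(2) deg(1,2) deg(5)[of w] by (cases "w = y") auto
  next
    fix w assume w: "w \<in> X \<union> Y"
    consider "w = y" | "w = x0" | "w \<noteq> y" "w \<noteq> x0" "w \<in> X" | "w \<noteq> y" "w \<noteq> x0" "w \<in> Y"
      using w by blast
    then show "defect (reverse_arcs D A) w \<le> defect D w"
    proof cases
      case 1
      then show ?thesis using inn[of y] deg(1,2) y(1,2) S(2) half_y yS by (simp add: defectY)
    next
      case 2
      then show ?thesis using out[of x0] deg(3,4) x0(1) x0y by (simp add: defectX)
    next
      case 3
      then show ?thesis using out[of w] deg(5)[of w] by (simp add: defectX)
    next
      case 4
      then have "w \<notin> S" using SX disj by auto
      then show ?thesis using 4 inn[of w] deg(5)[of w] by (simp add: defectY)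
    qed
  next
    show "defect (reverse_arcs D A) x0 < defect D x0"
      using out[of x0] deg(3,4) x0 x0y by (simp add: defectX)
  qed (use x0(1) in auto)
qed

text \<open>Let \<open>R\<close> consist of the vertices from which \<open>x0\<close> can be reached; no arc enters \<open>R\<close> from outside.
  The forbidden improvements show that, within \<open>R\<close>, every vertex of \<open>X\<close> has out-degree at most half,
  and every vertex of \<open>Y\<close> either has in-degree \<open>half y + 2\<close>, or has in-degree \<open>half y - 1 \<ge> 2\<close> and at
  most two out-neighbours in \<open>R\<close>. So no vertex of \<open>R\<close> has more out-arcs inside \<open>R\<close> than in-arcs,
  while \<open>x0\<close> has fewer.\<close>

lemma optimal_X_no_defect:
  assumes opt: "optimal D" and "x0 \<in> X"
  shows "defect D x0 = 0"
proof (rule ccontr)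
  assume def0: "defect D x0 \<noteq> 0"
  then have x0: "outdeg D x0 < half x0" using \<open>x0 \<in> X\<close> by (simp add: defectX)
  have adm: "admissible D" using opt by (simp add: optimal_def)
  note D = admissible_orientation[OF adm]
  define R where "R = {v \<in> X \<union> Y. (v, x0) \<in> D\<^sup>*}"
  have RX: "outdeg D x \<le> half x" if x: "x \<in> R" "x \<in> X" for x
  proof (rule ccontr)
    assume "\<not> ?thesis"
    moreover have "outdeg D x \<le> half x + 1" using adm x(2) by (simp add: admissible_def)
    ultimately have "outdeg D x = half x + 1" by simp
    moreover have "(x, x0) \<in> D\<^sup>*" using x(1) by (simp add: R_def)
    ultimately show False
      using optimal_no_transfer[OF opt, of x x0] x(2) \<open>x0 \<in> X\<close> x0 def0 by simp
  qed
  have RY: "defect D y = 0" if y: "y \<in> R" "y \<in> Y" for y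
  proof (rule ccontr)
    assume "\<not> ?thesis"
    moreover have "(y, x0) \<in> D\<^sup>*" using y(1) by (simp add: R_def)
    ultimately show False
      using optimal_no_transfer[OF opt, of y x0] y(2) \<open>x0 \<in> X\<close> x0 def0 by simp
  qed
  have RYout: "card (D `` {y} \<inter> R) \<le> 2" if y: "y \<in> R" "y \<in> Y" "indeg D y < half y" for y
  proof (rule ccontr)
    assume many: "\<not> ?thesis"
    have "y \<notin> X" using y(2) disj by auto
    then have "D `` {y} \<subseteq> X" using D(3) by blast
    then have "\<And>x. x \<in> D `` {y} \<inter> R \<Longrightarrow> outdeg D x \<le> half x" using RX by blast
    moreover have "indeg D y = half y - 1" using RY[OF y(1,2)] y(2,3) by (simp add: defectY)
    moreover have "(y, x0) \<in> D\<^sup>*" using y(1) by (simp add: R_def)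
    ultimately show False
      using optimal_no_large_fan[OF opt \<open>x0 \<in> X\<close> x0 y(2), of "D `` {y} \<inter> R"] many by simp
  qed
  show False
  proof (rule no_strict_surplus_on_closed_set[of "D\<inverse>" R x0])
    show "finite (D\<inverse>)" "finite R" using D(1) finX finY by (auto simp: R_def)
    show "D\<inverse> `` R \<subseteq> R"
      using D(3) by (auto simp: R_def intro: converse_rtrancl_into_rtrancl)
    have le: "card ((D\<inverse>)\<inverse> `` {v} \<inter> R) \<le> outdeg D v" for v
      using D(1) by (auto intro: card_mono)
    show "x0 \<in> R" using \<open>x0 \<in> X\<close> by (simp add: R_def)
    show "card ((D\<inverse>)\<inverse> `` {x0} \<inter> R) < outdeg (D\<inverse>) x0"
      using le[of x0] D(4)[of x0] x0 half_bounds(2)[of x0] \<open>x0 \<in> X\<close> by simp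
    fix v assume v: "v \<in> R"
    then have vV: "v \<in> X \<union> Y" by (auto simp: R_def)
    note hb = half_bounds[OF vV]
    show "card ((D\<inverse>)\<inverse> `` {v} \<inter> R) \<le> outdeg (D\<inverse>) v"
    proof (cases "v \<in> X")
      case True
      then show ?thesis using le[of v] RX[OF v] D(4)[of v] hb by simp
    next
      case False
      then have vY: "v \<in> Y" using vV by auto
      show ?thesis
      proof (cases "indeg D v < half v")
        case True
        then have "indeg D v = half v - 1" using RY[OF v vY] vY by (simp add: defectY)
        then show ?thesis using RYout[OF v vY True] hb by simp
      next
        case False
        then show ?thesis using RY[OF v vY] vY le[of v] D(4)[of v] hb by (simp add: defectY)
      qed
    qed
  qed
qed

section \<open>Defects in Y are impossible\<close>

text \<open>An in-degree of \<open>half y\<close> or \<open>half y + 1\<close> lies strictly between the two admitted values.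
  Reversing the arcs from \<open>S\<close> lowers it to \<open>half y - 1\<close> and costs nothing at the tails, which keep
  out-degree \<open>half x\<close>.\<close>

lemma optimal_no_reversible_in_star:
  assumes opt: "optimal D"
    and y: "y \<in> Y" "half y \<le> indeg D y" "indeg D y \<le> half y + 1"
    and S: "S \<subseteq> D\<inverse> `` {y}" "card S + half y = indeg D y + 1"
      "\<And>x. x \<in> S \<Longrightarrow> outdeg D x = half x + 1"
  shows False
proof -
  have adm: "admissible D" using opt by (simp add: optimal_def)
  note D = admissible_orientation[OF adm]
  have SX: "S \<subseteq> X" using S(1) D(3) y(1) disj by blast
  have finS: "finite S" using S(1) D(1) finite_subset by (metis finite_Image finite_converse)
  define A where "A = ({} \<union> {y} \<times> S)\<inverse>"
  have A: "A \<subseteq> D" using S(1) by (auto simp: A_def)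
  have A': "A\<inverse> = {} \<union> {y} \<times> S" "A = ({} \<union> {y} \<times> S)\<inverse>" by (simp_all add: A_def)
  have inA: "indeg A w = (if w = y then card S else 0)" for w
    using degrees_add_fan(1)[of "{}" S y w] finS unfolding A'(1) by simp
  have outA: "outdeg A w = (if w \<in> S then 1 else 0)" for w
    using degrees_add_fan(2)[of "{}" S y w] finS unfolding A'(2) by simp
  note out = outdeg_reverse_arcs[OF D(1,2) A, unfolded inA outA]
  note inn = indeg_reverse_arcs[OF D(1,2) A, unfolded inA outA]
  have half_y: "3 \<le> half y" using half_bounds(1) y(1) by blast
  have yS: "y \<notin> S" using SX y(1) disj by auto
  have defy: "defect (reverse_arcs D A) y < defect D y"
    using inn[of y] y S(2) half_y yS by (simp add: defectY)
  show False
  proof (rule optimal_no_reversal[OF opt A _ _ _ _ defy])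
    fix x assume x: "x \<in> X"
    then have "outdeg D x \<le> half x + 1" "x \<noteq> y"
      using adm y(1) disj by (auto simp: admissible_def)
    then show "outdeg D x + indeg A x \<le> half x + 1 + outdeg A x"
      unfolding inA outA by simp
  next
    fix w assume w: "w \<in> Y"
    then have "indeg D w \<le> half w + 2" "w \<notin> S"
      using adm SX disj by (auto simp: admissible_def)
    then show "indeg D w + outdeg A w \<le> half w + 2 + indeg A w"
      unfolding inA outA by simp
  next
    fix w assume w: "w \<in> X \<union> Y"
    consider "w = y" | "w \<noteq> y" "w \<in> X" | "w \<noteq> y" "w \<in> Y" using w by blast
    then show "defect (reverse_arcs D A) w \<le> defect D w"
    proof cases
      case 1
      then show ?thesis using defy by simp
    next
      case 2
      then show ?thesis using out[of w] S(3)[of w] by (auto simp: defectX split: if_splits)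
    next
      case 3
      then have "w \<notin> S" using SX disj by auto
      then show ?thesis using 3 inn[of w] by (simp add: defectY)
    qed
  qed (use y(1) in auto)
qed

text \<open>Now \<open>y\<close> jumps from in-degree \<open>half y + 2\<close> down to \<open>half y - 1\<close>: one in-arc is reversed with a path
  from the defective vertex \<open>y0\<close>, one at a tail \<open>x1\<close> from \<open>T\<close>, which can spare it, and a third one at
  an arbitrary tail \<open>x2\<close>. The last reversal may cost 1 at \<open>x2\<close>, which the gain at \<open>y0\<close> pays
  for. Hence the new orientation is optimal too, so it has no defect at \<open>x2\<close> after all, and the
  gain at \<open>y0\<close> is a genuine improvement.\<close>

lemma optimal_no_two_saturated:
  assumes opt: "optimal D" and y0: "y0 \<in> Y" "0 < defect D y0"
    and y: "y \<in> Y" "indeg D y = half y + 2" "(y0, y) \<in> D\<^sup>*"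
    and T: "T \<subseteq> D\<inverse> `` {y}" "2 \<le> card T" "\<And>x. x \<in> T \<Longrightarrow> outdeg D x = half x + 1"
  shows False
proof -
  have adm: "admissible D" using opt by (simp add: optimal_def)
  note D = admissible_orientation[OF adm]
  have "y0 \<noteq> y" using y0 y(2) y(1) by (auto simp: defectY)
  then obtain P where P: "P \<subseteq> D" "path_arcs P y0 y"
    using path_arcs_exist[OF y(3)] by blast
  note deg = path_arcs_degrees[OF P(2)]
  have finP: "finite (P\<inverse>)" using P(1) D(1) finite_subset by (metis finite_converse)
  have half_y: "3 \<le> half y" using half_bounds(1) y(1) by blast
  \<comment> \<open>The tail \<open>b\<close> of the last arc of the path is the one in-neighbour of \<open>y\<close> already used.\<close>
  obtain b where b: "P\<inverse> `` {y} = {b}" using deg(4) card_1_singletonE by metis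
  have "card T \<le> 1" if "T \<subseteq> {b}" using card_mono[OF _ that] by simp
  then obtain x1 where x1: "x1 \<in> T" "x1 \<noteq> b" using T(2) by fastforce
  have "3 \<le> card (D\<inverse> `` {y} - {b, x1})"
    using diff_card_le_card_Diff[of "{b, x1}" "D\<inverse> `` {y}"] y(2) half_y x1(2) by simp
  then have "D\<inverse> `` {y} - {b, x1} \<noteq> {}" by fastforce
  then obtain x2 where x2: "x2 \<in> D\<inverse> `` {y}" "x2 \<noteq> b" "x2 \<noteq> x1" by blast
  define S where "S = {x1, x2}"
  have S: "S \<subseteq> D\<inverse> `` {y} - {b}" "card S = 2" "finite S"
    using x1 x2 T(1) by (auto simp: S_def)
  have SX: "S \<subseteq> X" using S(1) D(3) y(1) disj by blast
  define A where "A = (P\<inverse> \<union> {y} \<times> S)\<inverse>"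
  have A: "A \<subseteq> D" using P(1) S(1) by (auto simp: A_def)
  have A': "A\<inverse> = P\<inverse> \<union> {y} \<times> S" "A = (P\<inverse> \<union> {y} \<times> S)\<inverse>" by (simp_all add: A_def)
  have disjS: "P\<inverse> `` {y} \<inter> S = {}" using S(1) b by auto
  have inA: "indeg A w = indeg P w + (if w = y then 2 else 0)" for w
    using degrees_add_fan(1)[OF finP S(3) disjS, of w] S(2) unfolding A'(1) by simp
  have outA: "outdeg A w = outdeg P w + (if w \<in> S then 1 else 0)" for w
    using degrees_add_fan(2)[OF finP S(3) disjS, of w] unfolding A'(2) by simp
  note out = outdeg_reverse_arcs[OF D(1,2) A, unfolded inA outA]
  note inn = indeg_reverse_arcs[OF D(1,2) A, unfolded inA outA]
  have yS: "y \<notin> S" "y0 \<notin> S" using SX y(1) y0(1) disj by auto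
  let ?D = "reverse_arcs D A"
  have adm': "admissible ?D"
  proof (rule admissible_reverse_arcs[OF adm A])
    fix x assume x: "x \<in> X"
    then have "outdeg D x \<le> half x + 1" "x \<noteq> y" "x \<noteq> y0"
      using adm y(1) y0(1) disj by (auto simp: admissible_def)
    then show "outdeg D x + indeg A x \<le> half x + 1 + outdeg A x"
      unfolding inA outA using deg(5)[of x] by simp
  next
    fix w assume w: "w \<in> Y"
    then have le: "indeg D w \<le> half w + 2" "w \<notin> S"
      using adm SX disj by (auto simp: admissible_def)
    have "indeg D y0 < half y0 + 2"
      using y0 by (auto simp: defectY split: if_splits)
    then show "indeg D w + outdeg A w \<le> half w + 2 + indeg A w"
      unfolding inA outA using le deg(1-4) deg(5)[of w] by (cases "w = y"; cases "w = y0") auto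
  qed
  have defy0: "defect ?D y0 < defect D y0"
    using inn[of y0] deg(1,2) yS \<open>y0 \<noteq> y\<close> y0 by (auto simp: defectY split: if_splits)
  have defY: "defect ?D w \<le> defect D w" if w: "w \<in> Y" for w
  proof -
    have wS: "w \<notin> S" using w SX disj by auto
    consider "w = y" | "w = y0" | "w \<noteq> y" "w \<noteq> y0" by blast
    then show ?thesis
    proof cases
      case 1
      then show ?thesis using inn[of y] deg(3,4) y(1,2) yS half_y by (simp add: defectY)
    next
      case 2
      then show ?thesis using defy0 by simp
    next
      case 3
      then show ?thesis using inn[of w] deg(5)[of w] w wS by (simp add: defectY)
    qed
  qed
  have defX: "defect ?D x \<le> defect D x + (if x = x2 then 1 else 0)" if x: "x \<in> X" for x
  proof -
    have "x \<noteq> y" "x \<noteq> y0" using x y(1) y0(1) disj by auto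
    then show ?thesis
      using out[of x] deg(5)[of x] x T(3)[OF x1(1)] by (auto simp: defectX S_def split: if_splits)
  qed
  have x2X: "x2 \<in> X" using SX by (simp add: S_def)
  have "(\<Sum>v\<in>X \<union> Y. defect ?D v + (if v = y0 then 1 else 0))
      \<le> (\<Sum>v\<in>X \<union> Y. defect D v + (if v = x2 then 1 else 0))"
  proof (rule sum_mono)
    fix v assume v: "v \<in> X \<union> Y"
    show "defect ?D v + (if v = y0 then 1 else 0) \<le> defect D v + (if v = x2 then 1 else 0)"
      using v defX[of v] defY[of v] defy0 y0(1) disj by (cases "v \<in> X") auto
  qed
  then have "total_defect ?D \<le> total_defect D"
    unfolding total_defect_def sum.distrib using finX finY y0(1) x2X by simp
  then have opt': "optimal ?D"
    using adm' opt unfolding optimal_def by (meson le_trans)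
  show False
  proof (rule optimal_no_improvement[OF opt adm' _ _ defy0])
    fix v assume "v \<in> X \<union> Y"
    then show "defect ?D v \<le> defect D v"
      using optimal_X_no_defect[OF opt'] defY by fastforce
  qed (use y0 in auto)
qed

text \<open>Let \<open>R\<close> consist of the vertices that can be reached from \<open>y0\<close>; no arc leaves \<open>R\<close>. Within \<open>R\<close>,
  every vertex of \<open>X\<close> has out-degree \<open>half x + 1\<close>, more than half its degree. A vertex of \<open>Y\<close> has
  in-degree below half, or at most one in-neighbour in \<open>R\<close>. The latter leaves no surplus of in-arcs
  inside \<open>R\<close>, since even at in-degree \<open>half y + 2\<close> at least \<open>half y - 2 \<ge> 1\<close> out-arcs remain,
  and at \<open>y0\<close> there are strictly fewer in-arcs from \<open>R\<close> than out-arcs.\<close>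

lemma optimal_Y_no_defect:
  assumes opt: "optimal D" and "y0 \<in> Y"
  shows "defect D y0 = 0"
proof (rule ccontr)
  assume "defect D y0 \<noteq> 0"
  then have def0: "0 < defect D y0" by simp
  have adm: "admissible D" using opt by (simp add: optimal_def)
  note D = admissible_orientation[OF adm]
  define R where "R = {v \<in> X \<union> Y. (y0, v) \<in> D\<^sup>*}"
  have RX: "outdeg D x = half x + 1" if x: "x \<in> R" "x \<in> X" for x
  proof (rule ccontr)
    assume "\<not> ?thesis"
    moreover have "outdeg D x \<le> half x + 1" using adm x(2) by (simp add: admissible_def)
    ultimately have "outdeg D x \<le> half x" by simp
    moreover have "(y0, x) \<in> D\<^sup>*" using x(1) by (simp add: R_def)
    ultimately show False
      using optimal_no_transfer[OF opt, of y0 x] x(2) \<open>y0 \<in> Y\<close> def0 by simp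
  qed
  have inR: "outdeg D x = half x + 1" if "x \<in> D\<inverse> `` {y} \<inter> R" "y \<in> Y" for x y
  proof -
    have "x \<in> X" using that D(3) disj by blast
    then show ?thesis using RX that by blast
  qed
  have RYmid: "card (D\<inverse> `` {y} \<inter> R) + half y < indeg D y + 1"
    if y: "y \<in> Y" "half y \<le> indeg D y" "indeg D y \<le> half y + 1" for y
  proof (rule ccontr)
    assume "\<not> ?thesis"
    then have "indeg D y + 1 - half y \<le> card (D\<inverse> `` {y} \<inter> R)" by simp
    then obtain S where "S \<subseteq> D\<inverse> `` {y} \<inter> R" "card S = indeg D y + 1 - half y"
      by (rule obtain_subset_with_card_n)
    then show False using optimal_no_reversible_in_star[OF opt y, of S] inR[OF _ y(1)] y(2) by auto
  qed
  have RYtop: "card (D\<inverse> `` {y} \<inter> R) \<le> 1" if y: "y \<in> R" "y \<in> Y" "indeg D y = half y + 2" for y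
  proof (rule ccontr)
    assume "\<not> ?thesis"
    moreover have "(y0, y) \<in> D\<^sup>*" using y(1) by (simp add: R_def)
    ultimately show False
      using optimal_no_two_saturated[OF opt \<open>y0 \<in> Y\<close> def0 y(2,3), of "D\<inverse> `` {y} \<inter> R"]
        inR[OF _ y(2)] by auto
  qed
  have le: "card (D\<inverse> `` {v} \<inter> R) \<le> indeg D v" for v
    using D(1) by (auto intro: card_mono)
  have Y: "card (D\<inverse> `` {v} \<inter> R) \<le> outdeg D v \<and>
      (indeg D v \<noteq> half v + 2 \<longrightarrow> card (D\<inverse> `` {v} \<inter> R) < outdeg D v)"
    if v: "v \<in> R" "v \<in> Y" for v
  proof -
    have hb: "3 \<le> half v" "2 * half v \<le> outdeg D v + indeg D v"
      using half_bounds[of v] v(2) D(4)[of v] by simp_all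
    have "indeg D v \<le> half v + 2" using adm v(2) by (simp add: admissible_def)
    then consider "indeg D v < half v" | "half v \<le> indeg D v" "indeg D v \<le> half v + 1"
      | "indeg D v = half v + 2" by linarith
    then show ?thesis
    proof cases
      case 1
      then show ?thesis using le[of v] hb by linarith
    next
      case 2
      then show ?thesis using RYmid[OF v(2) 2] hb by linarith
    next
      case 3
      then show ?thesis using RYtop[OF v 3] hb by linarith
    qed
  qed
  show False
  proof (rule no_strict_surplus_on_closed_set[of D R y0])
    show "finite D" "finite R" using D(1) finX finY by (auto simp: R_def)
    show "D `` R \<subseteq> R"
      using D(3) by (auto simp: R_def intro: rtrancl_into_rtrancl)
    show y0R: "y0 \<in> R" using \<open>y0 \<in> Y\<close> by (simp add: R_def)
    have "indeg D y0 \<noteq> half y0 + 2" using def0 \<open>y0 \<in> Y\<close> by (auto simp: defectY)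
    then show "card (D\<inverse> `` {y0} \<inter> R) < outdeg D y0" using Y[OF y0R \<open>y0 \<in> Y\<close>] by blast
    fix v assume v: "v \<in> R"
    then have vV: "v \<in> X \<union> Y" by (auto simp: R_def)
    show "card (D\<inverse> `` {v} \<inter> R) \<le> outdeg D v"
    proof (cases "v \<in> X")
      case True
      then show ?thesis using le[of v] RX[OF v] D(4)[of v] half_bounds(3)[OF vV] by simp
    next
      case False
      then show ?thesis using Y[OF v] vV by blast
    qed
  qed
qed

theorem separating_orientation:
  "\<exists>D. orientation U D \<and>
     (\<forall>x\<in>X. outdeg D x = half x \<or> outdeg D x = half x + 1) \<and>
     (\<forall>y\<in>Y. indeg D y = half y - 1 \<or> indeg D y = half y + 2)"
proof -
  obtain D where opt: "optimal D" using exists_optimal by blast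
  then have adm: "admissible D" by (simp add: optimal_def)
  have "outdeg D x = half x \<or> outdeg D x = half x + 1" if "x \<in> X" for x
    using adm optimal_X_no_defect[OF opt that] that
    by (force simp: admissible_def defectX)
  moreover have "indeg D y = half y - 1 \<or> indeg D y = half y + 2" if "y \<in> Y" for y
    using adm optimal_Y_no_defect[OF opt that] that
    by (force simp: admissible_def defectY split: if_splits)
  ultimately show ?thesis using adm by (auto simp: admissible_def)
qed

end

section \<open>From orientations to weightings\<close>

text \<open>Edges directed from \<open>A\<close> to \<open>B\<close> receive weight 1. Equal multisets at adjacent vertices would force
  equal degrees, hence equal values of \<open>half\<close>, and one common number of 1s.\<close>

lemma weighting_of_bipartition:
  fixes V :: "'a set" and E :: "'a set set"
  assumes V: "simple_graph V E" "V \<noteq> {}" and deg: "min_degree V E \<ge> 6"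
    and AB: "A \<inter> B = {}" "A \<union> B = V" "\<And>e. e \<in> E \<Longrightarrow> \<exists>a\<in>A. \<exists>b\<in>B. e = {a, b}"
  shows "\<exists>w. edge_weighting 2 E w \<and> adjacent_vertex_distinguishing E w"
proof -
  have finV: "finite V" using V(1) by (simp add: simple_graph_def)
  have finE: "finite E"
    using V(1) finV by (auto simp: simple_graph_def intro: finite_subset[of E "Pow V"])
  define U where "U = {(u, v). {u, v} \<in> E}"
  have inc: "bij_betw (\<lambda>u. {v, u}) (U `` {v}) (incident_edges E v)" for v
  proof (rule bij_betwI')
    fix x y show "({v, x} = {v, y}) = (x = y)" by (auto simp: doubleton_eq_iff)
  next
    fix x assume "x \<in> U `` {v}"
    then show "{v, x} \<in> incident_edges E v" by (simp add: U_def incident_edges_def)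
  next
    fix e assume "e \<in> incident_edges E v"
    then have e: "e \<in> E" "v \<in> e" by (auto simp: incident_edges_def)
    then obtain a b where "e = {a, b}" using AB(3) by blast
    then have "e = {v, a} \<or> e = {v, b}" using e(2) by auto
    then show "\<exists>u\<in>U `` {v}. e = {v, u}" using e(1) by (auto simp: U_def)
  qed
  have degU: "degree E v = card (U `` {v})" for v
    using bij_betw_same_card[OF inc[of v]] by (simp add: degree_def)
  interpret bipartite_relation A B U
  proof
    show "finite A" "finite B" using finV AB(2) by auto
    show "A \<inter> B = {}" by (rule AB(1))
    show "U \<subseteq> A \<times> B \<union> B \<times> A"
      using AB(3) by (force simp: U_def doubleton_eq_iff)
    show "sym U" by (auto simp: U_def sym_def insert_commute)
    fix v assume "v \<in> A \<union> B"
    then have "min_degree V E \<le> degree E v"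
      unfolding min_degree_def using finV AB(2) by (intro Min_le) auto
    then show "6 \<le> card (U `` {v})" using deg degU[of v] by simp
  qed
  obtain D where D: "orientation U D"
      "\<And>x. x \<in> A \<Longrightarrow> outdeg D x = half x \<or> outdeg D x = half x + 1"
      "\<And>y. y \<in> B \<Longrightarrow> indeg D y = half y - 1 \<or> indeg D y = half y + 2"
    using separating_orientation by blast
  define w where "w e = (if \<exists>a\<in>A. \<exists>b\<in>B. e = {a, b} \<and> (a, b) \<in> D then 1 else 2 :: nat)" for e
  have w1: "w {a, b} = 1 \<longleftrightarrow> (a, b) \<in> D" "w {b, a} = 1 \<longleftrightarrow> (a, b) \<in> D"
    if "a \<in> A" "b \<in> B" for a b
    using that AB(1) by (auto simp: w_def doubleton_eq_iff)
  have DU: "D \<subseteq> U" using D(1) by (auto simp: orientation_def)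
  have ones: "count (incident_weights E w v) 1 = card {u \<in> U `` {v}. w {v, u} = 1}" for v
  proof -
    have fin: "finite (incident_edges E v)" using finE by (simp add: incident_edges_def)
    have "count (incident_weights E w v) 1 = card {e \<in> incident_edges E v. w e = 1}"
      unfolding incident_weights_def using fin
      by (auto simp: count_image_mset vimage_def Int_def conj_commute intro!: arg_cong[where f = card])
    also have "\<dots> = card {u \<in> U `` {v}. w {v, u} = 1}"
    proof (rule bij_betw_same_card[symmetric])
      show "bij_betw (\<lambda>u. {v, u}) {u \<in> U `` {v}. w {v, u} = 1} {e \<in> incident_edges E v. w e = 1}"
      proof (rule bij_betw_subset[OF inc[of v]])
        have surj: "incident_edges E v = (\<lambda>u. {v, u}) ` (U `` {v})"
          using inc[of v] by (simp add: bij_betw_def)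
        show "(\<lambda>u. {v, u}) ` {u \<in> U `` {v}. w {v, u} = 1} = {e \<in> incident_edges E v. w e = 1}"
          unfolding surj by auto
      qed auto
    qed
    finally show ?thesis .
  qed
  have onesA: "count (incident_weights E w a) 1 = outdeg D a" if a: "a \<in> A" for a
  proof -
    have "{u \<in> U `` {a}. w {a, u} = 1} = D `` {a}"
      using a between DU AB(1) w1(1)[OF a] by blast
    then show ?thesis unfolding ones by simp
  qed
  have onesB: "count (incident_weights E w b) 1 = indeg D b" if b: "b \<in> B" for b
  proof -
    have "{u \<in> U `` {b}. w {b, u} = 1} = D\<inverse> `` {b}"
      using b between DU AB(1) w1(2)[OF _ b] symU by (blast dest: symD)
    then show ?thesis unfolding ones by simp
  qed
  have size: "size (incident_weights E w v) = degree E v" for v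
    by (simp add: incident_weights_def degree_def)
  have AB_distinct: "incident_weights E w a \<noteq> incident_weights E w b" if "a \<in> A" "b \<in> B" for a b
  proof
    assume eq: "incident_weights E w a = incident_weights E w b"
    then have "half a = half b" using size[of a] size[of b] by (simp add: half_def degU)
    moreover have "outdeg D a = indeg D b" using eq onesA[OF that(1)] onesB[OF that(2)] by simp
    moreover have "3 \<le> half b" using half_bounds(1)[of b] that(2) by simp
    ultimately show False using D(2)[OF that(1)] D(3)[OF that(2)] by linarith
  qed
  have "incident_weights E w u \<noteq> incident_weights E w v" if "{u, v} \<in> E" for u v
  proof -
    obtain a b where ab: "a \<in> A" "b \<in> B" "{u, v} = {a, b}"
      using AB(3)[OF \<open>{u, v} \<in> E\<close>] by blast
    then show ?thesis using AB_distinct[OF ab(1,2)] by (auto simp: doubleton_eq_iff)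
  qed
  then have "adjacent_vertex_distinguishing E w"
    unfolding adjacent_vertex_distinguishing_def by blast
  moreover have "edge_weighting 2 E w" by (auto simp: edge_weighting_def w_def)
  ultimately show ?thesis by blast
qed

theorem theorem3p2:
  fixes V :: "'a set" and E :: "'a set set"
  assumes "simple_graph V E"
    and "nice V E"
    and "bipartite V E"
    and "min_degree V E \<ge> 6"
  shows "\<exists>w. edge_weighting 2 E w \<and> adjacent_vertex_distinguishing E w"
proof (cases "V = {}")
  \<comment> \<open>Without vertices the minimum degree is unspecified, so this case is separate.\<close>
  case True
  then have "E = {}" using assms(1) by (auto simp: simple_graph_def)
  then show ?thesis by (simp add: edge_weighting_def adjacent_vertex_distinguishing_def)
next
  case False
  then show ?thesis
    using weighting_of_bipartition[OF assms(1) _ assms(4)] assms(3) unfolding bipartite_def by metis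
qed

end
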